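(* Let $K$ be a field, let $P=K[a_0,a_1,\dots,a_n]$, let $S$ be a $K$-subalgebra of $P$, and let $g\in P$ with $g\neq 0$. Then: (a) $S:g^\infty\subseteq \mathrm{wSat}_g(S)$. (b) $\mathrm{wSat}_g(\mathrm{wSat}_g(S))=\mathrm{wSat}_g(S)$. (c) If $A$ is a $K$-subalgebra of $P$ with $S\subseteq A\subseteq \mathrm{wSat}_g(S)$, then $\mathrm{wSat}_g(A)=\mathrm{wSat}_g(S)$. (d) If $g\in S$, then $S:g^\infty=\mathrm{wSat}_g(S)=\mathrm{Sat}_g(S)$.
   Context: For a $K$-subalgebra $S$ of $P$ and $0\ne g\in P$ (all computations taking place in the localization $P[g^{-1}]$): the weak saturation of $S$ with respect to $g$ is $\mathrm{wSat}_g(S)=S[g^{-1}]\cap P$; the saturation of $S$ with respect to $g$ is $\mathrm{Sat}_g(S)=S[g,g^{-1}]\cap P$; for $i\in\mathbb N$, $S:g^i$ is the set $\{f\in P\mid g^i f\in S\}$; and $S:g^\infty$ is the set $\bigcup_{i\in\mathbb N}(S:g^i)$ (where $0\in\mathbb N$). *)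

theory Defs
  imports "HOL-Library.Poly_Mapping" "HOL-Computational_Algebra.Fraction_Field"
begin

text \<open>
  Polynomials over \<open>'k\<close> in the variables \<open>a\<^sub>0, a\<^sub>1, a\<^sub>2, \<dots>\<close>: a monomial is a finitely supported
  exponent vector \<open>nat \<Rightarrow>\<^sub>0 nat\<close>, a polynomial a finitely supported coefficient function on
  monomials. \<open>Poly_Mapping\<close> makes this type an integral domain.
\<close>

type_synonym 'k mpoly = "(nat \<Rightarrow>\<^sub>0 nat) \<Rightarrow>\<^sub>0 'k"

definition Const :: "'k \<Rightarrow> 'k::field mpoly" where
  "Const c = Poly_Mapping.single 0 c"

text \<open>\<open>polys n\<close> is \<open>K[a\<^sub>0, \<dots>, a\<^sub>n]\<close>, so it has \<open>n + 1\<close> variables.\<close>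

definition polys :: "nat \<Rightarrow> 'k::field mpoly set" where
  "polys n = {p. \<forall>m \<in> Poly_Mapping.keys p. Poly_Mapping.keys m \<subseteq> {0..n}}"

text \<open>
  In the next two definitions \<open>\<phi>\<close> is the structure map \<open>K \<rightarrow> R\<close> of a commutative \<open>K\<close>-algebra with
  carrier \<open>R\<close>; the scalar multiple of \<open>x\<close> by \<open>c\<close> is \<open>\<phi> c * x\<close>. Subalgebras contain \<open>1\<close>.
\<close>

definition subalgebra :: "('k::field \<Rightarrow> 'r::comm_ring_1) \<Rightarrow> 'r set \<Rightarrow> 'r set \<Rightarrow> bool" where
  "subalgebra \<phi> R S \<longleftrightarrow>
     S \<subseteq> R \<and> 0 \<in> S \<and> 1 \<in> S \<and>
     (\<forall>x\<in>S. \<forall>y\<in>S. x + y \<in> S) \<and>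
     (\<forall>x\<in>S. \<forall>y\<in>S. x * y \<in> S) \<and>
     (\<forall>c. \<forall>x\<in>S. \<phi> c * x \<in> S)"

definition generated_subalgebra :: "('k::field \<Rightarrow> 'r::comm_ring_1) \<Rightarrow> 'r set \<Rightarrow> 'r set \<Rightarrow> 'r set" where
  "generated_subalgebra \<phi> R X = \<Inter> {T. subalgebra \<phi> R T \<and> X \<subseteq> T}"

definition embed :: "'k::field mpoly \<Rightarrow> 'k mpoly fract" where
  "embed f = Fract f 1"

text \<open>\<open>P[g\<^sup>-\<^sup>1]\<close> for \<open>P = polys n\<close> and \<open>g \<noteq> 0\<close>, as a subring of the field of fractions.\<close>

definition localization :: "nat \<Rightarrow> 'k::field mpoly \<Rightarrow> 'k mpoly fract set" where
  "localization n g = {Fract f (g ^ k) | f k. f \<in> polys n}"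

abbreviation subalgebra_P :: "nat \<Rightarrow> 'k::field mpoly set \<Rightarrow> bool" where
  "subalgebra_P n S \<equiv> subalgebra Const (polys n) S"

definition wSat :: "nat \<Rightarrow> 'k::field mpoly \<Rightarrow> 'k mpoly set \<Rightarrow> 'k mpoly set" where
  "wSat n g S =
     {f \<in> polys n. embed f \<in>
        generated_subalgebra (embed \<circ> Const) (localization n g)
          (embed ` S \<union> {inverse (embed g)})}"

definition Sat :: "nat \<Rightarrow> 'k::field mpoly \<Rightarrow> 'k mpoly set \<Rightarrow> 'k mpoly set" where
  "Sat n g S =
     {f \<in> polys n. embed f \<in>
        generated_subalgebra (embed \<circ> Const) (localization n g)
          (embed ` S \<union> {embed g, inverse (embed g)})}"

definition colon_pow :: "nat \<Rightarrow> 'k::field mpoly set \<Rightarrow> 'k mpoly \<Rightarrow> nat \<Rightarrow> 'k mpoly set" where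
  "colon_pow n S g i = {f \<in> polys n. g ^ i * f \<in> S}"

definition colon_inf :: "nat \<Rightarrow> 'k::field mpoly set \<Rightarrow> 'k mpoly \<Rightarrow> 'k mpoly set" where
  "colon_inf n S g = (\<Union>i. colon_pow n S g i)"

text \<open>
  The ambient objects are algebras; in particular the intersection in \<open>generated_subalgebra\<close> is
  taken over a nonempty family in the definitions of \<open>wSat\<close> and \<open>Sat\<close>.
\<close>

lemma polys_mult:
  fixes f :: "'k::field mpoly"
  assumes "f \<in> polys n" "h \<in> polys n"
  shows "f * h \<in> polys n"
  unfolding polys_def
proof (intro CollectI ballI)
  fix m assume "m \<in> Poly_Mapping.keys (f * h)"
  then obtain a b where ab: "m = a + b" "a \<in> Poly_Mapping.keys f" "b \<in> Poly_Mapping.keys h"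
    using keys_mult[of f h] by blast
  have "Poly_Mapping.keys m \<subseteq> Poly_Mapping.keys a \<union> Poly_Mapping.keys b"
    unfolding ab(1) by (rule Poly_Mapping.keys_add)
  with ab assms show "Poly_Mapping.keys m \<subseteq> {0..n}"
    unfolding polys_def by blast
qed

lemma polys_add:
  fixes f :: "'k::field mpoly"
  assumes "f \<in> polys n" "h \<in> polys n"
  shows "f + h \<in> polys n"
  using assms Poly_Mapping.keys_add[of f h] unfolding polys_def by blast

lemma polys_Const: "Const c \<in> polys n"
  by (auto simp: polys_def Const_def)

lemma polys_0: "0 \<in> polys n" and polys_1: "1 \<in> polys n"
  by (auto simp: polys_def)

lemma polys_power: "g \<in> polys n \<Longrightarrow> g ^ k \<in> polys n"
  by (induction k) (auto simp: polys_1 polys_mult)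

lemma subalgebra_polys: "subalgebra_P n (polys n :: 'k::field mpoly set)"
  by (auto simp: subalgebra_def intro: polys_0 polys_1 polys_add polys_mult polys_Const)

lemma subalgebra_localization:
  fixes g :: "'k::field mpoly"
  assumes g: "g \<in> polys n" "g \<noteq> 0"
  shows "subalgebra (embed \<circ> Const) (localization n g) (localization n g)"
proof -
  have loc: "Fract f (g ^ k) \<in> localization n g" if "f \<in> polys n" for f k
    using that unfolding localization_def by blast
  have emb: "embed f \<in> localization n g" if "f \<in> polys n" for f
    using loc[OF that, of 0] by (simp add: embed_def)
  have mult: "x * y \<in> localization n g"
    if xy: "x \<in> localization n g" "y \<in> localization n g" for x y
  proof -
    obtain f k h l where "x = Fract f (g ^ k)" "y = Fract h (g ^ l)" "f \<in> polys n" "h \<in> polys n"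
      using xy unfolding localization_def by blast
    then show ?thesis
      using loc[of "f * h" "k + l"] by (simp add: power_add polys_mult)
  qed
  have add: "x + y \<in> localization n g"
    if xy: "x \<in> localization n g" "y \<in> localization n g" for x y
  proof -
    obtain f k h l where "x = Fract f (g ^ k)" "y = Fract h (g ^ l)" "f \<in> polys n" "h \<in> polys n"
      using xy unfolding localization_def by blast
    then show ?thesis
      using loc[of "f * g ^ l + h * g ^ k" "k + l"] g
      by (simp add: power_add polys_mult polys_add polys_power)
  qed
  have "0 \<in> localization n g" "1 \<in> localization n g"
    using emb[OF polys_0] emb[OF polys_1]
    by (simp_all add: embed_def Zero_fract_def One_fract_def)
  then show ?thesis
    unfolding subalgebra_def using add mult emb[OF polys_Const] by auto
qed

end

theory Submission
  imports Defs
begin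

text \<open>
  Write \<open>S[g\<^sup>-\<^sup>1]\<close> for the algebra generated by \<open>S\<close> and \<open>g\<^sup>-\<^sup>1\<close> inside the localization. Its universal
  property makes \<open>S \<mapsto> wSat n g S\<close> a closure operator on subsets of \<open>polys n\<close>: it is extensive,
  and \<open>A \<subseteq> wSat n g B\<close> already forces \<open>A[g\<^sup>-\<^sup>1] \<subseteq> B[g\<^sup>-\<^sup>1]\<close>, hence \<open>wSat n g A \<subseteq> wSat n g B\<close>
  (\<open>wSat_subset\<close>). Idempotence and the statement on intermediate algebras are formal consequences.

  If \<open>g\<^sup>i f \<in> S\<close> then \<open>f = (g\<^sup>-\<^sup>1)\<^sup>i (g\<^sup>i f)\<close> lies in \<open>S[g\<^sup>-\<^sup>1]\<close>, so \<open>S : g\<^sup>\<infinity>\<close> is contained in the weak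
  saturation. Conversely, if \<open>g \<in> S\<close>, the fractions \<open>s / g\<^sup>k\<close> with \<open>s \<in> S\<close> can be added over a common
  denominator with the numerator still in \<open>S\<close>, so they form an algebra (\<open>subalgebra_fractions\<close>) and every
  element of \<open>S[g\<^sup>-\<^sup>1]\<close> has this shape; clearing the denominator shows that the polynomials among
  these elements lie in \<open>S : g\<^sup>\<infinity>\<close>. Adjoining the
  element \<open>g\<close> of \<open>S\<close> once more changes nothing, whence the equality with \<open>Sat n g S\<close>.
\<close>

lemma subalgebra_power:
  assumes "subalgebra \<phi> R S" "x \<in> S"
  shows "x ^ k \<in> S"
  using assms by (induction k) (auto simp: subalgebra_def)

lemma generated_subalgebra_least:
  assumes "subalgebra \<phi> R T" "X \<subseteq> T"
  shows "generated_subalgebra \<phi> R X \<subseteq> T"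
  using assms unfolding generated_subalgebra_def by blast

lemma subset_generated_subalgebra: "X \<subseteq> generated_subalgebra \<phi> R X"
  unfolding generated_subalgebra_def by blast

text \<open>
  The hypothesis supplies \<open>R\<close> itself as a member of the intersected family, which might otherwise
  be empty and have intersection \<open>UNIV\<close>.
\<close>

lemma subalgebra_generated_subalgebra:
  assumes "subalgebra \<phi> R R" "X \<subseteq> R"
  shows "subalgebra \<phi> R (generated_subalgebra \<phi> R X)"
proof -
  have "generated_subalgebra \<phi> R X \<subseteq> R"
    using assms by (rule generated_subalgebra_least)
  then show ?thesis
    unfolding subalgebra_def generated_subalgebra_def by simp
qed

lemma embed_mult: "embed (f * h) = embed f * embed h"
  by (simp add: embed_def)

lemma embed_power: "embed (f ^ k) = embed f ^ k"
  by (induction k) (simp_all add: embed_mult, simp add: embed_def One_fract_def)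

lemma embed_eq_0_iff: "embed f = 0 \<longleftrightarrow> f = 0"
  by (simp add: embed_def Zero_fract_def eq_fract)

lemma embed_in_localization: "f \<in> polys n \<Longrightarrow> embed f \<in> localization n g"
  unfolding localization_def embed_def by (intro CollectI exI[of _ f] exI[of _ 0]) simp

lemma inverse_embed_in_localization: "inverse (embed g) \<in> localization n g"
  unfolding localization_def embed_def
  by (intro CollectI exI[of _ 1]) (simp add: polys_1)

lemma subalgebra_adjoin_inverse:
  assumes "S \<subseteq> polys n" "g \<in> polys n" "g \<noteq> 0"
  shows "subalgebra (embed \<circ> Const) (localization n g)
    (generated_subalgebra (embed \<circ> Const) (localization n g) (embed ` S \<union> {inverse (embed g)}))"
  using assms
  by (intro subalgebra_generated_subalgebra subalgebra_localization)
    (auto intro: embed_in_localization inverse_embed_in_localization)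

lemma subset_wSat: "S \<subseteq> polys n \<Longrightarrow> S \<subseteq> wSat n g S"
  unfolding wSat_def using subset_generated_subalgebra by fastforce

lemma wSat_subset_polys: "wSat n g S \<subseteq> polys n"
  unfolding wSat_def by blast

lemma wSat_subset:
  assumes "A \<subseteq> wSat n g B" "B \<subseteq> polys n" "g \<in> polys n" "g \<noteq> 0"
  shows "wSat n g A \<subseteq> wSat n g B"
proof -
  let ?gen = "\<lambda>X. generated_subalgebra (embed \<circ> Const) (localization n g)
    (embed ` X \<union> {inverse (embed g)})"
  have "embed ` A \<union> {inverse (embed g)} \<subseteq> ?gen B"
    using assms(1) subset_generated_subalgebra unfolding wSat_def by fastforce
  then have "?gen A \<subseteq> ?gen B"
    using assms(2-4) by (intro generated_subalgebra_least subalgebra_adjoin_inverse)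
  then show ?thesis
    unfolding wSat_def by blast
qed

lemma wSat_wSat:
  assumes "S \<subseteq> polys n" "g \<in> polys n" "g \<noteq> 0"
  shows "wSat n g (wSat n g S) = wSat n g S"
  using assms by (intro subset_antisym wSat_subset subset_wSat wSat_subset_polys order_refl)

lemma wSat_between:
  assumes "S \<subseteq> A" "A \<subseteq> wSat n g S" "S \<subseteq> polys n" "g \<in> polys n" "g \<noteq> 0"
  shows "wSat n g A = wSat n g S"
proof (rule subset_antisym)
  have A: "A \<subseteq> polys n"
    using assms(2) wSat_subset_polys by blast
  show "wSat n g S \<subseteq> wSat n g A"
    using subset_trans[OF assms(1) subset_wSat[OF A]] A assms(4,5) by (rule wSat_subset)
  show "wSat n g A \<subseteq> wSat n g S"
    using assms(2-5) by (rule wSat_subset)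
qed

lemma colon_inf_subset_wSat:
  assumes "S \<subseteq> polys n" "g \<in> polys n" "g \<noteq> 0"
  shows "colon_inf n S g \<subseteq> wSat n g S"
proof
  fix f assume "f \<in> colon_inf n S g"
  then obtain i where f: "f \<in> polys n" and i: "g ^ i * f \<in> S"
    unfolding colon_inf_def colon_pow_def by blast
  let ?G = "generated_subalgebra (embed \<circ> Const) (localization n g)
    (embed ` S \<union> {inverse (embed g)})"
  have G: "subalgebra (embed \<circ> Const) (localization n g) ?G"
    using assms by (rule subalgebra_adjoin_inverse)
  have gens: "embed ` S \<union> {inverse (embed g)} \<subseteq> ?G"
    by (rule subset_generated_subalgebra)
  have "inverse (embed g) ^ i \<in> ?G"
    using gens by (intro subalgebra_power[OF G]) blast
  moreover have "embed (g ^ i * f) \<in> ?G"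
    using gens i by blast
  ultimately have "inverse (embed g) ^ i * embed (g ^ i * f) \<in> ?G"
    using G unfolding subalgebra_def by blast
  moreover have "inverse (embed g) ^ i * embed (g ^ i * f) = embed f"
    using assms(3) by (simp add: embed_mult embed_power embed_eq_0_iff power_inverse field_simps)
  ultimately show "f \<in> wSat n g S"
    using f unfolding wSat_def by simp
qed

lemma subalgebra_fractions:
  assumes S: "subalgebra_P n S" and g: "g \<in> S" "g \<noteq> 0"
  shows "subalgebra (embed \<circ> Const) (localization n g) {Fract s (g ^ k) | s k. s \<in> S}"
    (is "subalgebra _ _ ?T")
proof -
  have SP: "S \<subseteq> polys n" and S0: "0 \<in> S" and S1: "1 \<in> S"
    using S unfolding subalgebra_def by blast+
  have Sadd: "x + y \<in> S" and Smult: "x * y \<in> S" if "x \<in> S" "y \<in> S" for x y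
    using S that unfolding subalgebra_def by blast+
  have Sscale: "Const c * x \<in> S" if "x \<in> S" for c x
    using S that unfolding subalgebra_def by blast
  have T: "Fract s (g ^ k) \<in> ?T" if "s \<in> S" for s k
    using that by blast
  have add: "x + y \<in> ?T" if xy: "x \<in> ?T" "y \<in> ?T" for x y
  proof -
    obtain s k t l where "x = Fract s (g ^ k)" "y = Fract t (g ^ l)" "s \<in> S" "t \<in> S"
      using xy by blast
    then show ?thesis
      using T[of "s * g ^ l + t * g ^ k" "k + l"] g subalgebra_power[OF S g(1)]
      by (simp add: power_add Sadd Smult)
  qed
  have mult: "x * y \<in> ?T" if xy: "x \<in> ?T" "y \<in> ?T" for x y
  proof -
    obtain s k t l where "x = Fract s (g ^ k)" "y = Fract t (g ^ l)" "s \<in> S" "t \<in> S"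
      using xy by blast
    then show ?thesis
      using T[of "s * t" "k + l"] by (simp add: power_add Smult)
  qed
  have scale: "(embed \<circ> Const) c * x \<in> ?T" if x: "x \<in> ?T" for c x
  proof -
    obtain s k where "x = Fract s (g ^ k)" "s \<in> S"
      using x by blast
    then show ?thesis
      using T[of "Const c * s" k] by (simp add: embed_def Sscale)
  qed
  have "0 \<in> ?T" "1 \<in> ?T"
    using T[OF S0, of 0] T[OF S1, of 0]
    by (simp_all add: Zero_fract_def One_fract_def)
  moreover have "?T \<subseteq> localization n g"
    using SP unfolding localization_def by blast
  ultimately show ?thesis
    unfolding subalgebra_def by (intro conjI ballI allI add mult scale)
qed

lemma wSat_subset_colon_inf:
  assumes S: "subalgebra_P n S" and g: "g \<in> S" "g \<noteq> 0"
  shows "wSat n g S \<subseteq> colon_inf n S g"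
proof
  fix f assume f: "f \<in> wSat n g S"
  let ?T = "{Fract s (g ^ k) | s k. s \<in> S}"
  have "embed s \<in> ?T" if "s \<in> S" for s
    unfolding embed_def using that by (intro CollectI exI[of _ s] exI[of _ 0]) simp
  moreover have "inverse (embed g) \<in> ?T"
    unfolding embed_def using S
    by (intro CollectI exI[of _ 1]) (simp add: subalgebra_def)
  ultimately have "embed ` S \<union> {inverse (embed g)} \<subseteq> ?T"
    by blast
  then have "generated_subalgebra (embed \<circ> Const) (localization n g)
      (embed ` S \<union> {inverse (embed g)}) \<subseteq> ?T"
    by (rule generated_subalgebra_least[OF subalgebra_fractions[OF assms]])
  then obtain s k where "s \<in> S" "embed f = Fract s (g ^ k)"
    using f unfolding wSat_def by blast
  then have "g ^ k * f \<in> S"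
    using g(2) by (simp add: embed_def eq_fract mult.commute)
  then show "f \<in> colon_inf n S g"
    using f unfolding wSat_def colon_inf_def colon_pow_def by blast
qed

lemma Sat_eq_wSat:
  assumes "g \<in> S"
  shows "Sat n g S = wSat n g S"
proof -
  have "embed ` S \<union> {embed g, inverse (embed g)} = embed ` S \<union> {inverse (embed g)}"
    using assms by blast
  then show ?thesis
    by (simp only: Sat_def wSat_def)
qed

theorem proposition2p4:
  fixes n :: nat and S :: "'k::field mpoly set" and g :: "'k mpoly"
  assumes "subalgebra_P n S" and "g \<in> polys n" and "g \<noteq> 0"
  shows "colon_inf n S g \<subseteq> wSat n g S
    \<and> wSat n g (wSat n g S) = wSat n g S
    \<and> (\<forall>A. subalgebra_P n A \<and> S \<subseteq> A \<and> A \<subseteq> wSat n g S \<longrightarrow> wSat n g A = wSat n g S)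
    \<and> (g \<in> S \<longrightarrow> colon_inf n S g = wSat n g S \<and> wSat n g S = Sat n g S)"
proof -
  have S: "S \<subseteq> polys n"
    using assms(1) unfolding subalgebra_def by blast
  show ?thesis
    using colon_inf_subset_wSat[OF S assms(2,3)] wSat_wSat[OF S assms(2,3)]
      wSat_between[OF _ _ S assms(2,3)] wSat_subset_colon_inf[OF assms(1) _ assms(3)]
      Sat_eq_wSat[of g S n]
    by blast
qed

end
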